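(* Assume (a) $\mu$ is a strong limit singular cardinal; (b) $\lambda=2^\mu=\mathrm{cf}(\lambda)$; (c) $\langle\lambda_i:i<\delta\rangle$ is an increasing sequence of regular cardinals with limit $\mu$, where $\delta<\mu$ is a limit ordinal; (d) $J$ is an ideal on $\delta$ extending $J^{\mathrm{bd}}_\delta$; (e) $\lambda=\mathrm{tcf}\big(\prod_{i<\delta}\lambda_i/J\big)$; (f) $|\delta|<\sigma=\mathrm{cf}(\sigma)<\lambda_0$. Let $I_i=J^{\mathrm{nst},\sigma}_{\lambda_i}$ for $i<\delta$. Then there is a $(\lambda,J)$-sequence for $\langle I_i:i<\delta\rangle$, and even a super one.
   Context: Ideals are proper; $I^+=\{A\subseteq\mathrm{Dom}(I):A\notin I\}$. $J^{\mathrm{bd}}_\delta$ is the ideal of bounded subsets of $\delta$. For regular $\chi>\sigma$, $J^{\mathrm{nst},\sigma}_\chi$ is the ideal of all $A\subseteq\chi$ such that $\{\alpha\in A:\mathrm{cf}(\alpha)=\sigma\}$ is not stationary in $\chi$. $\mathrm{tcf}(P)=\lambda$ means that $P$ has an increasing cofinal sequence of length $\lambda$. For ideals $J_\ell$ ($\ell<n$), $\prod_{\ell<n}J_\ell$ is the ideal on $\prod_{\ell<n}\mathrm{Dom}(J_\ell)$ with $X\in(\prod_{\ell<n}J_\ell)^+$ iff $(\exists^{J_0^+}x_0)\cdots(\exists^{J_{n-1}^+}x_{n-1})\,\langle x_0,\dots,x_{n-1}\rangle\in X$, where $(\exists^{J^+}x)\varphi(x)$ means $\{x:\varphi(x)\}\in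 J^+$. $\bar\eta=\langle\eta_\alpha:\alpha<\lambda\rangle$ is a $(\lambda,J)$-sequence for $\langle I_i:i<\delta\rangle$ if $\eta_\alpha\in\prod_{i<\delta}\mathrm{Dom}(I_i)$ and for every unbounded $X\subseteq\lambda$, $\{i<\delta:\{\eta_\alpha(i):\alpha\in X\}\in I_i\}\in J$. It is super if in addition, for every $n<\omega$ and pairwise distinct $\beta_{\alpha,\ell}<\lambda$ ($\alpha<\lambda$, $\ell<n$) with $\beta_{\alpha,\ell}$ increasing in $\ell$: (i) $\{i<\delta:\{\langle\eta_{\beta_{\alpha,\ell}}(i):\ell<n\rangle:\alpha<\lambda\}\in\prod_{\ell<n}I_i\}\in J$; and moreover (ii) for some $A\in J$, for all $m<\omega$ and all $i_0<\dots<i_{m-1}$ in $\delta\setminus A$, $\{\langle\langle\eta_{\beta_{\alpha,\ell}}(i_t):\ell<n\rangle:t<m\rangle:\alpha<\lambda\}\in\big(\prod_{t<m}\big(\prod_{\ell<n}I_{i_t}\big)\big)^+$. *)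

theory Defs
  imports Main "HOL-Library.Equipollence" "HOL-Library.FuncSet"
begin

text \<open>
  Ordinals are elements of an arbitrary well-ordered type; the ordinal \<open>\<alpha>\<close> stands for the set
  \<open>{..<\<alpha>}\<close> of its predecessors. Cardinals are initial ordinals, and cardinalities are compared by
  the relations \<open>\<approx>\<close> and \<open>\<prec>\<close> on sets. Natural numbers (finite indices) have type \<open>nat\<close>.
\<close>

definition ord_zero :: "'a::wellorder" where
  "ord_zero = (LEAST x. True)"

definition limit_ord :: "'a::wellorder \<Rightarrow> bool" where
  "limit_ord \<delta> \<longleftrightarrow> {..<\<delta>} \<noteq> {} \<and> (\<forall>x<\<delta>. \<exists>y<\<delta>. x < y)"

text \<open>With \<open>\<le>\<close> rather than \<open><\<close> in the next definition, successor ordinals get cofinality \<open>1\<close>;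
  for limit \<open>\<alpha>\<close> the two versions agree.\<close>

definition unbounded_in :: "'a::wellorder \<Rightarrow> 'a set \<Rightarrow> bool" where
  "unbounded_in \<alpha> X \<longleftrightarrow> X \<subseteq> {..<\<alpha>} \<and> (\<forall>x<\<alpha>. \<exists>y\<in>X. x \<le> y)"

definition cf :: "'a::wellorder \<Rightarrow> 'a" where
  "cf \<alpha> = (LEAST \<beta>. \<exists>f. unbounded_in \<alpha> (f ` {..<\<beta>}))"

definition cardinal :: "'a::wellorder \<Rightarrow> bool" where
  "cardinal \<kappa> \<longleftrightarrow> (\<forall>\<alpha><\<kappa>. {..<\<alpha>} \<prec> {..<\<kappa>})"

definition regular_cardinal :: "'a::wellorder \<Rightarrow> bool" where
  "regular_cardinal \<kappa> \<longleftrightarrow> cardinal \<kappa> \<and> infinite {..<\<kappa>} \<and> cf \<kappa> = \<kappa>"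

definition singular_cardinal :: "'a::wellorder \<Rightarrow> bool" where
  "singular_cardinal \<kappa> \<longleftrightarrow> cardinal \<kappa> \<and> infinite {..<\<kappa>} \<and> cf \<kappa> < \<kappa>"

definition strong_limit :: "'a::wellorder \<Rightarrow> bool" where
  "strong_limit \<kappa> \<longleftrightarrow> cardinal \<kappa> \<and> infinite {..<\<kappa>} \<and> (\<forall>\<alpha><\<kappa>. Pow {..<\<alpha>} \<prec> {..<\<kappa>})"

definition club :: "'a::wellorder \<Rightarrow> 'a set \<Rightarrow> bool" where
  "club \<chi> C \<longleftrightarrow> unbounded_in \<chi> C \<and>
     (\<forall>\<gamma><\<chi>. limit_ord \<gamma> \<and> unbounded_in \<gamma> (C \<inter> {..<\<gamma>}) \<longrightarrow> \<gamma> \<in> C)"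

definition stationary :: "'a::wellorder \<Rightarrow> 'a set \<Rightarrow> bool" where
  "stationary \<chi> S \<longleftrightarrow> S \<subseteq> {..<\<chi>} \<and> (\<forall>C. club \<chi> C \<longrightarrow> S \<inter> C \<noteq> {})"

text \<open>An ideal is recorded together with its domain, since the domain is not always determined by
  the family of small sets.\<close>

record 'x idl =
  Dom :: "'x set"
  small :: "'x set set"

definition is_ideal :: "'x idl \<Rightarrow> bool" where
  "is_ideal I \<longleftrightarrow> small I \<subseteq> Pow (Dom I) \<and> {} \<in> small I \<and> Dom I \<notin> small I \<and>
     (\<forall>A\<in>small I. \<forall>B\<subseteq>A. B \<in> small I) \<and>
     (\<forall>A\<in>small I. \<forall>B\<in>small I. A \<union> B \<in> small I)"

definition pos :: "'x idl \<Rightarrow> 'x set set" where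
  "pos I = {A. A \<subseteq> Dom I \<and> A \<notin> small I}"

definition J_bd :: "'a::wellorder \<Rightarrow> 'a idl" where
  "J_bd \<delta> = \<lparr>Dom = {..<\<delta>}, small = {A. A \<subseteq> {..<\<delta>} \<and> \<not> unbounded_in \<delta> A}\<rparr>"

definition J_nst :: "'a::wellorder \<Rightarrow> 'a \<Rightarrow> 'a idl" where
  "J_nst \<sigma> \<chi> =
     \<lparr>Dom = {..<\<chi>}, small = {A. A \<subseteq> {..<\<chi>} \<and> \<not> stationary \<chi> {\<alpha>\<in>A. cf \<alpha> = \<sigma>}}\<rparr>"

text \<open>Finite products of ideals; the tuple \<open>\<langle>x\<^sub>0, \<dots>, x\<^sub>n\<^sub>-\<^sub>1\<rangle>\<close> is the list \<open>[x\<^sub>0, \<dots>, x\<^sub>n\<^sub>-\<^sub>1]\<close>, and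
  \<open>ex_pos [J\<^sub>0, \<dots>, J\<^sub>n\<^sub>-\<^sub>1] \<phi>\<close> is the iterated quantifier over \<open>J\<^sub>0\<^sup>+\<close> (outermost) to \<open>J\<^sub>n\<^sub>-\<^sub>1\<^sup>+\<close>.\<close>

fun ex_pos :: "'x idl list \<Rightarrow> ('x list \<Rightarrow> bool) \<Rightarrow> bool" where
  "ex_pos [] \<phi> \<longleftrightarrow> \<phi> []"
| "ex_pos (I # Is) \<phi> \<longleftrightarrow> {x \<in> Dom I. ex_pos Is (\<lambda>xs. \<phi> (x # xs))} \<in> pos I"

definition tuples :: "'x idl list \<Rightarrow> 'x list set" where
  "tuples Is = {xs. length xs = length Is \<and> (\<forall>l<length Is. xs ! l \<in> Dom (Is ! l))}"

definition prod_idl :: "'x idl list \<Rightarrow> 'x list idl" where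
  "prod_idl Is =
     \<lparr>Dom = tuples Is, small = {X. X \<subseteq> tuples Is \<and> \<not> ex_pos Is (\<lambda>xs. xs \<in> X)}\<rparr>"

text \<open>\<open>has_tcf P lt \<kappa>\<close> says that the true cofinality of \<open>P\<close> with strict order \<open>lt\<close> is \<open>\<kappa>\<close>. The
  product modulo \<open>J\<close> is represented by the functions themselves, with the strict order
  \<open>less_mod J\<close>.\<close>

definition has_tcf :: "'p set \<Rightarrow> ('p \<Rightarrow> 'p \<Rightarrow> bool) \<Rightarrow> 'a::wellorder \<Rightarrow> bool" where
  "has_tcf P lt \<kappa> \<longleftrightarrow> (\<exists>f. (\<forall>\<alpha><\<kappa>. f \<alpha> \<in> P) \<and>
     (\<forall>\<alpha> \<beta>. \<alpha> < \<beta> \<and> \<beta> < \<kappa> \<longrightarrow> lt (f \<alpha>) (f \<beta>)) \<and>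
     (\<forall>p\<in>P. \<exists>\<alpha><\<kappa>. p = f \<alpha> \<or> lt p (f \<alpha>)))"

definition less_mod :: "'i idl \<Rightarrow> ('i \<Rightarrow> 'a::wellorder) \<Rightarrow> ('i \<Rightarrow> 'a) \<Rightarrow> bool" where
  "less_mod J f g \<longleftrightarrow> {i \<in> Dom J. \<not> f i < g i} \<in> small J"

definition lJ_sequence ::
  "'a::wellorder \<Rightarrow> 'i idl \<Rightarrow> 'i set \<Rightarrow> ('i \<Rightarrow> 'x idl) \<Rightarrow> ('a \<Rightarrow> 'i \<Rightarrow> 'x) \<Rightarrow> bool" where
  "lJ_sequence lam J D I \<eta> \<longleftrightarrow>
     (\<forall>\<alpha><lam. \<eta> \<alpha> \<in> (\<Pi>\<^sub>E i\<in>D. Dom (I i))) \<and>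
     (\<forall>X. unbounded_in lam X \<longrightarrow> {i\<in>D. {\<eta> \<alpha> i | \<alpha>. \<alpha> \<in> X} \<in> small (I i)} \<in> small J)"

definition super_lJ_sequence ::
  "'a::wellorder \<Rightarrow> 'i::wellorder idl \<Rightarrow> 'i set \<Rightarrow> ('i \<Rightarrow> 'x idl) \<Rightarrow> ('a \<Rightarrow> 'i \<Rightarrow> 'x) \<Rightarrow> bool"
  where
  "super_lJ_sequence lam J D I \<eta> \<longleftrightarrow> lJ_sequence lam J D I \<eta> \<and>
     (\<forall>(n::nat) (\<beta> :: 'a \<Rightarrow> nat \<Rightarrow> 'a).
        (\<forall>\<alpha><lam. \<forall>l<n. \<beta> \<alpha> l < lam) \<and>
        inj_on (\<lambda>(\<alpha>, l). \<beta> \<alpha> l) ({..<lam} \<times> {..<n}) \<and>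
        (\<forall>\<alpha><lam. strict_mono_on {..<n} (\<beta> \<alpha>)) \<longrightarrow>
        {i\<in>D. {map (\<lambda>l. \<eta> (\<beta> \<alpha> l) i) [0..<n] | \<alpha>. \<alpha> < lam}
                \<in> small (prod_idl (replicate n (I i)))} \<in> small J \<and>
        (\<exists>A\<in>small J. \<forall>(m::nat) (i :: nat \<Rightarrow> 'i).
           (\<forall>t<m. i t \<in> D - A) \<and> strict_mono_on {..<m} i \<longrightarrow>
           {map (\<lambda>t. map (\<lambda>l. \<eta> (\<beta> \<alpha> l) (i t)) [0..<n]) [0..<m] | \<alpha>. \<alpha> < lam}
             \<in> pos (prod_idl (map (\<lambda>t. prod_idl (replicate n (I (i t)))) [0..<m]))))"

end

theory Submission
  imports Defs
begin

text \<open>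
  The proof builds a sequence \<open>\<eta>\<close> that is generic for all strategies built from clubs. If a set of
  \<open>n\<close>-tuples is null in the \<open>n\<close>-fold power of \<open>I\<^sub>i\<close>, this is witnessed by a tree of clubs of \<open>\<lambda>\<^sub>i\<close>: one
  club for the first entry, then for each first entry a club for the second, and so on, such
  that no tuple of points of cofinality \<open>\<sigma>\<close> that follows the tree lies in the set
  (\<open>ex_pos_avoid\<close>). A choice of such a tree for every \<open>i < \<delta>\<close>, a club system, is
  coded by a set of finite sequences below \<open>\<mu>\<close>, so there are only \<open>2\<^sup>\<mu> = \<lambda>\<close> of them.

  Given fewer than \<open>\<lambda>\<close> sequences of clubs, some function in the product has all values of cofinality
  \<open>\<sigma>\<close> and lies in almost all clubs, modulo \<open>J\<close>, of each of the sequences (\<open>generic_function\<close>).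
  This uses that the product is \<open>\<lambda>\<close>-directed modulo \<open>J\<close> and that \<open>|\<delta>| < \<sigma>\<close>. Hence a recursion of
  length \<open>\<lambda>\<close> produces \<open>\<eta>\<close> such that \<open>\<eta>\<^sub>\<alpha>\<close> meets the demands of the first \<open>\<alpha>\<close> club systems on all finite
  tuples of earlier members (\<open>generic_sequence\<close>). For each club system, every increasing finite
  tuple from a final segment of \<open>\<lambda>\<close> then follows it at almost all \<open>i\<close>. Among \<open>\<lambda>\<close> pairwise disjoint
  tuples one lies in the final segment, so its values at almost all \<open>i\<close> refute a system that
  was supposed to avoid them.

  For several coordinates \<open>i\<^sub>0 < \<dots> < i\<^sub>m\<^sub>-\<^sub>1\<close> the trees of clubs interact, but since the \<open>\<lambda>\<^sub>i\<close> increase,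
  the dependence on smaller coordinates can be removed by intersecting clubs (\<open>prod_avoid\<close>). Since
  there are fewer than \<open>\<lambda>\<^sub>i\<close> finite sequences of coordinates, the systems for all of them can be
  intersected as well, which gives one exceptional set for all of them (\<open>tuples_positive\<close>). The
  remaining requirements are the cases of one coordinate and of 1-tuples.
\<close>

section \<open>Cardinality and cofinality\<close>

context includes cardinal_syntax
begin

lemma lists_lepoll_self:
  assumes "infinite A"
  shows "lists A \<lesssim> A"
proof -
  have le: "\<not> finite A" using assms by simp
  have "|{xs. set xs \<subseteq> A \<and> length xs = n}| \<le>o |A|" for n
  proof (induction n)
    case 0
    have "A \<noteq> {}" using assms by auto
    moreover have "{xs. set xs \<subseteq> A \<and> length xs = 0} = {[]}" by auto
    ultimately show ?case by (metis card_of_singl_ordLeq)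
  next
    case (Suc n)
    let ?L = "\<lambda>n. {xs. set xs \<subseteq> A \<and> length xs = n}"
    have "?L (Suc n) \<subseteq> (\<lambda>(x, xs). x # xs) ` (A \<times> ?L n)"
      by (auto simp: length_Suc_conv)
    then have "|?L (Suc n)| \<le>o |A \<times> ?L n|"
      by (rule surj_imp_ordLeq)
    also have "|A \<times> ?L n| \<le>o |A|"
      using card_of_Times_ordLeq_infinite_Field[of "|A|" A] Suc le card_of_mono1[of A A]
        card_of_card_order_on[of A] by (simp add: Field_card_of)
    finally show ?case .
  qed
  moreover have "|UNIV :: nat set| \<le>o |A|"
    using assms infinite_iff_card_of_nat by blast
  ultimately have "|\<Union>n. {xs. set xs \<subseteq> A \<and> length xs = n}| \<le>o |A|"
    by (intro card_of_UNION_ordLeq_infinite[OF le]) simp_all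
  moreover have "(\<Union>n. {xs. set xs \<subseteq> A \<and> length xs = n}) = lists A"
    by (auto simp: lists_eq_set)
  ultimately show ?thesis
    unfolding lepoll_def card_of_ordLeq by simp
qed

end

text \<open>Smallness of \<open>K\<close> is given as \<open>K \<prec> {..<\<chi>}\<close>, while \<open>cf\<close> speaks of functions on proper initial
  segments. A \<open>K\<close> that no proper initial segment maps onto would admit an injection
  from \<open>\<chi>\<close>, found by always choosing an element of \<open>K\<close> that is not yet a value.\<close>

lemma regular_bounded:
  assumes reg: "regular_cardinal \<chi>" and K: "K \<prec> {..<\<chi>}"
    and h: "\<And>k. k \<in> K \<Longrightarrow> h k < \<chi>"
  shows "\<exists>y<\<chi>. \<forall>k\<in>K. h k < y"
proof (cases "K = {}")
  case True
  then show ?thesis using reg unfolding regular_cardinal_def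
    by (metis ball_empty ex_in_conv finite.emptyI lessThan_iff)
next
  case False
  then obtain k0 where k0: "k0 \<in> K" by blast
  obtain \<beta> s where \<beta>: "\<beta> < \<chi>" and s: "K \<subseteq> s ` {..<\<beta>}"
  proof (rule ccontr)
    assume "\<not> thesis"
    then have no: "\<And>\<beta> s. \<beta> < \<chi> \<Longrightarrow> \<not> K \<subseteq> s ` {..<\<beta>}" using that by blast
    have "\<exists>e. \<forall>\<alpha>. \<alpha> < \<chi> \<longrightarrow> e \<alpha> \<in> K - e ` {..<\<alpha>}"
    proof (rule dependent_wellorder_choice)
      fix r and f g :: "'a \<Rightarrow> 'b" and x assume "\<And>y. y < x \<Longrightarrow> f y = g y"
      then have "f ` {..<x} = g ` {..<x}" by (intro image_cong) auto
      then show "(x < \<chi> \<longrightarrow> r \<in> K - f ` {..<x}) = (x < \<chi> \<longrightarrow> r \<in> K - g ` {..<x})" by simp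
    next
      fix x and f :: "'a \<Rightarrow> 'b"
      show "\<exists>r. x < \<chi> \<longrightarrow> r \<in> K - f ` {..<x}" using no[of x f] by blast
    qed
    then obtain e where e: "\<And>\<alpha>. \<alpha> < \<chi> \<Longrightarrow> e \<alpha> \<in> K - e ` {..<\<alpha>}" by blast
    have "inj_on e {..<\<chi>}"
    proof (rule linorder_inj_onI)
      fix x y assume "x < y" "y \<in> {..<\<chi>}"
      then show "e x \<noteq> e y" using e[of y] by (metis DiffD2 imageI lessThan_iff)
    qed auto
    then have "{..<\<chi>} \<lesssim> K" unfolding lepoll_def using e by blast
    then show False using K lesspoll_trans2 lesspoll_not_refl by blast
  qed
  show ?thesis
  proof (rule ccontr)
    assume "\<not> ?thesis"
    then have unb: "\<And>y. y < \<chi> \<Longrightarrow> \<exists>k\<in>K. y \<le> h k" by (meson not_le)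
    define f where "f b = h (if s b \<in> K then s b else k0)" for b
    have "f b < \<chi>" for b unfolding f_def using h k0 by simp
    moreover have "\<exists>y\<in>f ` {..<\<beta>}. x \<le> y" if "x < \<chi>" for x
      using unb[OF that] s unfolding f_def by (force simp: image_iff subset_iff)
    ultimately have "unbounded_in \<chi> (f ` {..<\<beta>})"
      unfolding unbounded_in_def by blast
    then have "cf \<chi> \<le> \<beta>" unfolding cf_def by (intro Least_le) blast
    then show False using reg \<beta> unfolding regular_cardinal_def by simp
  qed
qed

lemma regular_above:
  assumes "regular_cardinal \<chi>" "x < \<chi>"
  shows "\<exists>y<\<chi>. x < y"
  using regular_bounded[of \<chi> "{x}" "\<lambda>k. k"] assms
  by (auto simp: regular_cardinal_def finite_lesspoll_infinite)

lemma regular_sup: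
  assumes "regular_cardinal \<chi>" and "x < \<chi>" and "y < \<chi>"
  shows "\<exists>z<\<chi>. x < z \<and> y < (z::'a::wellorder)"
  using regular_above[OF assms(1), of "max x y"] assms by auto

lemma unbounded_in_eqpoll:
  assumes reg: "regular_cardinal \<chi>" and X: "unbounded_in \<chi> X"
  shows "X \<approx> {..<\<chi>}"
proof -
  have "X \<lesssim> {..<\<chi>}" using X by (simp add: unbounded_in_def subset_imp_lepoll)
  moreover have "\<not> X \<prec> {..<\<chi>}"
  proof
    assume "X \<prec> {..<\<chi>}"
    from regular_bounded[OF reg this, of "\<lambda>x. x"] X
    obtain y where "y < \<chi>" "\<forall>x\<in>X. x < y" unfolding unbounded_in_def by blast
    with X show False unfolding unbounded_in_def by (meson not_le)
  qed
  ultimately show ?thesis by (simp add: lepoll_iff_leqpoll)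
qed

text \<open>A cofinal map into \<open>s\<close> from fewer than \<open>\<sigma>\<close> points would, on replacing each value by the index
  of a term of \<open>\<nu>\<close> above it, give a cofinal subset of \<open>\<sigma>\<close> of the same small size.\<close>

lemma cf_sup_increasing:
  assumes \<sigma>: "regular_cardinal \<sigma>"
    and mono: "\<And>\<zeta> \<epsilon>. \<zeta> < \<epsilon> \<Longrightarrow> \<epsilon> < \<sigma> \<Longrightarrow> \<nu> \<zeta> < \<nu> \<epsilon>"
    and below: "\<And>\<epsilon>. \<epsilon> < \<sigma> \<Longrightarrow> \<nu> \<epsilon> < s"
    and cofinal: "\<And>x. x < s \<Longrightarrow> \<exists>\<epsilon><\<sigma>. x \<le> \<nu> \<epsilon>"
  shows "cf s = \<sigma>"
proof -
  have "unbounded_in s (\<nu> ` {..<\<sigma>})"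
    unfolding unbounded_in_def using below cofinal by auto
  then have "cf s \<le> \<sigma>" unfolding cf_def by (intro Least_le) blast
  moreover have "\<not> cf s < \<sigma>"
  proof
    assume lt: "cf s < \<sigma>"
    have "\<exists>f. unbounded_in s (f ` {..<cf s})" unfolding cf_def
      by (rule LeastI_ex) (use \<open>unbounded_in s (\<nu> ` {..<\<sigma>})\<close> in blast)
    then obtain f where f: "unbounded_in s (f ` {..<cf s})" by blast
    define h where "h b = (LEAST \<epsilon>. f b \<le> \<nu> \<epsilon>)" for b
    have h: "h b < \<sigma> \<and> f b \<le> \<nu> (h b)" if "b < cf s" for b
    proof -
      have "f b < s" using f that unfolding unbounded_in_def by auto
      then obtain \<epsilon> where "\<epsilon> < \<sigma>" "f b \<le> \<nu> \<epsilon>" using cofinal by blast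
      then show ?thesis unfolding h_def by (metis (no_types, lifting) LeastI Least_le le_less_trans)
    qed
    have "{..<cf s} \<prec> {..<\<sigma>}" using lt \<sigma> unfolding regular_cardinal_def cardinal_def by blast
    from regular_bounded[OF \<sigma> this, of h] h
    obtain \<epsilon> where \<epsilon>: "\<epsilon> < \<sigma>" "\<forall>b<cf s. h b < \<epsilon>" by auto
    obtain b where b: "b < cf s" "\<nu> \<epsilon> \<le> f b"
      using f below[OF \<epsilon>(1)] unfolding unbounded_in_def by blast
    have "\<nu> (h b) < \<nu> \<epsilon>" using mono \<epsilon> b by blast
    with b h[OF b(1)] show False by auto
  qed
  ultimately show ?thesis by auto
qed

section \<open>Closed unbounded sets\<close>

lemma club_lessThan: "regular_cardinal \<chi> \<Longrightarrow> club \<chi> {..<\<chi>}"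
  unfolding club_def unbounded_in_def by auto

lemma club_above:
  assumes "regular_cardinal \<chi>" "club \<chi> C" "x < \<chi>"
  shows "\<exists>c\<in>C. x < c"
  using regular_above[OF assms(1,3)] assms(2) unfolding club_def unbounded_in_def
  by (meson less_le_trans)

lemma club_below: "club \<chi> C \<Longrightarrow> c \<in> C \<Longrightarrow> c < \<chi>"
  unfolding club_def unbounded_in_def by auto

lemma club_gap:
  assumes "club \<chi> C" "\<gamma> < \<chi>" "limit_ord \<gamma>" "\<gamma> \<notin> C"
  shows "\<exists>x<\<gamma>. \<forall>c\<in>C. x \<le> c \<longrightarrow> \<gamma> < c"
proof -
  have "\<not> unbounded_in \<gamma> (C \<inter> {..<\<gamma>})" using assms unfolding club_def by blast
  then obtain x where x: "x < \<gamma>" "\<forall>c\<in>C \<inter> {..<\<gamma>}. \<not> x \<le> c" unfolding unbounded_in_def by blast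
  have "\<gamma> < c" if "c \<in> C" "x \<le> c" for c
    using x that assms(4) by (metis Int_iff lessThan_iff linorder_neqE)
  then show ?thesis using x by blast
qed

text \<open>Closing off \<open>\<omega>\<close> times reaches a common limit point of all the sets, which stays below \<open>\<chi>\<close>
  because \<open>\<chi>\<close> is uncountable. The factor \<open>{..<\<chi>}\<close> covers the empty family.\<close>

lemma club_INT:
  assumes reg: "regular_cardinal \<chi>" and unc: "(UNIV :: nat set) \<prec> {..<\<chi>}"
    and K: "K \<prec> {..<\<chi>}" and C: "\<And>k. k \<in> K \<Longrightarrow> club \<chi> (C k)"
  shows "club \<chi> ({..<\<chi>} \<inter> (\<Inter>k\<in>K. C k))"
proof -
  have "\<exists>z<\<chi>. x < z \<and> (\<forall>k\<in>K. \<exists>c\<in>C k. x < c \<and> c < z)" if x: "x < \<chi>" for x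
  proof -
    have "\<forall>k\<in>K. \<exists>c. c \<in> C k \<and> x < c" using club_above[OF reg C x] by blast
    then obtain c where c: "\<And>k. k \<in> K \<Longrightarrow> c k \<in> C k \<and> x < c k" by metis
    have "\<And>k. k \<in> K \<Longrightarrow> c k < \<chi>" using c C club_below by blast
    with regular_bounded[OF reg K, of c] obtain y where y: "y < \<chi>" "\<forall>k\<in>K. c k < y" by blast
    obtain z where z: "z < \<chi>" "x < z" "y < z" using regular_sup[OF reg x y(1)] by blast
    then show ?thesis using c y by (metis less_trans)
  qed
  then obtain nxt where nxt: "\<And>x. x < \<chi> \<Longrightarrow>
      nxt x < \<chi> \<and> x < nxt x \<and> (\<forall>k\<in>K. \<exists>c\<in>C k. x < c \<and> c < nxt x)" by metis
  have "\<exists>y\<in>{..<\<chi>} \<inter> (\<Inter>k\<in>K. C k). x \<le> y" if x: "x < \<chi>" for x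
  proof -
    define q where "q n = (nxt ^^ n) x" for n
    have q: "q n < \<chi>" for n unfolding q_def by (induction n) (use x nxt in auto)
    have qs: "q (Suc n) = nxt (q n)" for n unfolding q_def by simp
    from regular_bounded[OF reg unc, of q] q obtain b where b: "b < \<chi>" "\<forall>n. q n < b" by auto
    define \<gamma> where "\<gamma> = (LEAST y. \<forall>n. q n < y)"
    have qg: "q n < \<gamma>" for n unfolding \<gamma>_def using b LeastI[of "\<lambda>y. \<forall>n. q n < y" b] by blast
    have "\<gamma> \<le> b" unfolding \<gamma>_def using b by (simp add: Least_le)
    then have \<gamma>: "\<gamma> < \<chi>" using b by simp
    have cof: "\<exists>n. y < q n" if "y < \<gamma>" for y
    proof -
      have "\<not> (\<forall>n. q n < y)" using not_less_Least that unfolding \<gamma>_def by blast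
      then obtain n where "y \<le> q n" by (meson not_le)
      then show ?thesis using nxt[OF q[of n]] qs[of n] by (metis le_less_trans)
    qed
    have lim: "limit_ord \<gamma>" unfolding limit_ord_def using qg cof by blast
    have "\<gamma> \<in> C k" if "k \<in> K" for k
    proof -
      have "\<exists>c\<in>C k \<inter> {..<\<gamma>}. y \<le> c" if "y < \<gamma>" for y
      proof -
        from cof[OF that] obtain n where n: "y < q n" by blast
        have "\<exists>c\<in>C k. q n < c \<and> c < q (Suc n)" using nxt[OF q[of n]] \<open>k \<in> K\<close> qs by simp
        then obtain c where "c \<in> C k" "q n < c" "c < q (Suc n)" by blast
        then show ?thesis using n qg[of "Suc n"] by (intro bexI[of _ c]) auto
      qed
      then have "unbounded_in \<gamma> (C k \<inter> {..<\<gamma>})" unfolding unbounded_in_def by blast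
      then show ?thesis using C[OF that] \<gamma> lim unfolding club_def by blast
    qed
    moreover have "x \<le> \<gamma>" using qg[of 0] unfolding q_def by simp
    ultimately show ?thesis using \<gamma> by blast
  qed
  moreover have "\<gamma> \<in> {..<\<chi>} \<inter> (\<Inter>k\<in>K. C k)"
    if \<gamma>: "\<gamma> < \<chi>" "limit_ord \<gamma>" "unbounded_in \<gamma> (({..<\<chi>} \<inter> (\<Inter>k\<in>K. C k)) \<inter> {..<\<gamma>})" for \<gamma>
  proof -
    have "unbounded_in \<gamma> (C k \<inter> {..<\<gamma>})" if "k \<in> K" for k
      using \<gamma>(3) that unfolding unbounded_in_def by blast
    then show ?thesis using C \<gamma> unfolding club_def by blast
  qed
  ultimately show ?thesis unfolding club_def unbounded_in_def by auto
qed

section \<open>Meeting fewer than \<open>\<lambda>\<close> sequences of clubs\<close>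

locale scale =
  fixes lam \<delta> \<sigma> :: "'a::wellorder"
    and lams :: "'a \<Rightarrow> 'a"
    and J :: "'a idl"
  assumes lam_regular: "regular_cardinal lam"
    and lams_regular: "i < \<delta> \<Longrightarrow> regular_cardinal (lams i)"
    and J_ideal: "is_ideal J" and Dom_J: "Dom J = {..<\<delta>}"
    and tcf: "has_tcf (\<Pi>\<^sub>E i\<in>{..<\<delta>}. {..<lams i}) (less_mod J) lam"
    and \<sigma>_regular: "regular_cardinal \<sigma>"
    and \<delta>_less_\<sigma>: "{..<\<delta>} \<prec> {..<\<sigma>}"
    and \<sigma>_less: "i < \<delta> \<Longrightarrow> \<sigma> < lams i"
begin

lemma J_empty: "{} \<in> small J"
  using J_ideal unfolding is_ideal_def by blast

lemma J_subset: "A \<in> small J \<Longrightarrow> B \<subseteq> A \<Longrightarrow> B \<in> small J"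
  using J_ideal unfolding is_ideal_def by blast

lemma J_Un: "A \<in> small J \<Longrightarrow> B \<in> small J \<Longrightarrow> A \<union> B \<in> small J"
  using J_ideal unfolding is_ideal_def by blast

lemma J_finite_UN:
  assumes "finite K" "\<And>k. k \<in> K \<Longrightarrow> A k \<in> small J"
  shows "(\<Union>k\<in>K. A k) \<in> small J"
  using assms by (induction K rule: finite_induct) (auto intro: J_empty J_Un)

lemma less_mod_trans: "less_mod J f g \<Longrightarrow> less_mod J g h \<Longrightarrow> less_mod J f h"
  unfolding less_mod_def by (drule (1) J_Un, erule J_subset) (auto dest: less_trans)

text \<open>Each function lies below a member of the scale that witnesses the true cofinality, and by
  regularity fewer than \<open>lam\<close> such members have a common later one.\<close>

lemma directed:
  assumes K: "K \<prec> {..<lam}" and p: "\<And>k. k \<in> K \<Longrightarrow> p k \<in> (\<Pi>\<^sub>E i\<in>{..<\<delta>}. {..<lams i})"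
  shows "\<exists>g\<in>\<Pi>\<^sub>E i\<in>{..<\<delta>}. {..<lams i}. \<forall>k\<in>K. less_mod J (p k) g"
proof -
  obtain F where F: "\<And>\<alpha>. \<alpha> < lam \<Longrightarrow> F \<alpha> \<in> (\<Pi>\<^sub>E i\<in>{..<\<delta>}. {..<lams i})"
    "\<And>\<alpha> \<beta>. \<alpha> < \<beta> \<Longrightarrow> \<beta> < lam \<Longrightarrow> less_mod J (F \<alpha>) (F \<beta>)"
    "\<And>q. q \<in> (\<Pi>\<^sub>E i\<in>{..<\<delta>}. {..<lams i}) \<Longrightarrow> \<exists>\<alpha><lam. q = F \<alpha> \<or> less_mod J q (F \<alpha>)"
    using tcf unfolding has_tcf_def by metis
  obtain h where h: "\<And>k. k \<in> K \<Longrightarrow> h k < lam \<and> (p k = F (h k) \<or> less_mod J (p k) (F (h k)))"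
    using F(3)[OF p] by metis
  with regular_bounded[OF lam_regular K, of h]
  obtain \<alpha> where \<alpha>: "\<alpha> < lam" "\<forall>k\<in>K. h k < \<alpha>" by blast
  have "less_mod J (p k) (F \<alpha>)" if "k \<in> K" for k
    using h[OF that] F(2)[of "h k" \<alpha>] \<alpha> that less_mod_trans by metis
  then show ?thesis using F(1) \<alpha> by blast
qed

lemma step_above:
  assumes K: "\<C> \<prec> {..<lam}" and C: "\<And>C i. C \<in> \<C> \<Longrightarrow> i < \<delta> \<Longrightarrow> club (lams i) (C i)"
    and \<nu>: "\<nu> \<in> (\<Pi>\<^sub>E i\<in>{..<\<delta>}. {..<lams i})"
  shows "\<exists>g\<in>\<Pi>\<^sub>E i\<in>{..<\<delta>}. {..<lams i}. \<forall>C\<in>\<C>.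
           {i\<in>{..<\<delta>}. \<not> (\<exists>c\<in>C i. \<nu> i < c \<and> c < g i)} \<in> small J"
proof -
  have "\<exists>c. c \<in> C i \<and> \<nu> i < c" if "C \<in> \<C>" "i < \<delta>" for C i
    using club_above[OF lams_regular C, OF that(2) that, of "\<nu> i"] \<nu> that(2) by (auto simp: PiE_iff)
  then obtain nx where nx: "\<And>C i. C \<in> \<C> \<Longrightarrow> i < \<delta> \<Longrightarrow> nx C i \<in> C i \<and> \<nu> i < nx C i" by metis
  define p where "p C = restrict (nx C) {..<\<delta>}" for C
  have "p C \<in> (\<Pi>\<^sub>E i\<in>{..<\<delta>}. {..<lams i})" if "C \<in> \<C>" for C
    using nx[OF that] club_below[OF C, OF that] unfolding p_def by auto
  with directed[OF K, of p] obtain g where g: "g \<in> (\<Pi>\<^sub>E i\<in>{..<\<delta>}. {..<lams i})"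
    "\<And>C. C \<in> \<C> \<Longrightarrow> less_mod J (p C) g" by blast
  have "{i\<in>{..<\<delta>}. \<not> (\<exists>c\<in>C i. \<nu> i < c \<and> c < g i)} \<in> small J" if "C \<in> \<C>" for C
    using g(2)[OF that] unfolding less_mod_def
    by (rule J_subset) (use nx[OF that] in \<open>auto simp: p_def Dom_J\<close>)
  then show ?thesis using g(1) by blast
qed

text \<open>The values of \<open>\<eta>\<close> are suprema of a \<open>\<sigma>\<close>-chain of functions \<open>\<nu> \<epsilon>\<close> that increases in every
  coordinate, hence have cofinality \<open>\<sigma>\<close>. Between consecutive members of the chain each club sequence
  has points, outside a set in \<open>J\<close> that depends on \<open>\<epsilon>\<close>. These exceptional sets cannot be united,
  because \<open>J\<close> is only finitely additive. Instead, if \<open>\<eta> i \<notin> C i\<close>, then \<open>C i\<close> has no points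
  between \<open>\<nu> \<epsilon> i\<close> and \<open>\<eta> i\<close> from some \<open>\<epsilon> < \<sigma>\<close> on; as \<open>|\<delta>| < \<sigma>\<close> and \<open>\<sigma>\<close> is regular, one \<open>\<epsilon>\<close> serves all
  these \<open>i\<close>, which therefore all lie in the single exceptional set of that \<open>\<epsilon>\<close>.\<close>

lemma generic_function:
  assumes K: "\<C> \<prec> {..<lam}" and C: "\<And>C i. C \<in> \<C> \<Longrightarrow> i < \<delta> \<Longrightarrow> club (lams i) (C i)"
  shows "\<exists>\<eta>\<in>\<Pi>\<^sub>E i\<in>{..<\<delta>}. {..<lams i}. (\<forall>i<\<delta>. cf (\<eta> i) = \<sigma>) \<and>
           (\<forall>C\<in>\<C>. {i\<in>{..<\<delta>}. \<eta> i \<notin> C i} \<in> small J)"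
proof -
  let ?\<Pi> = "\<Pi>\<^sub>E i\<in>{..<\<delta>}. {..<lams i}"
  have "\<forall>\<nu>. \<exists>g. \<nu> \<in> ?\<Pi> \<longrightarrow> g \<in> ?\<Pi> \<and> (\<forall>C\<in>\<C>.
      {i\<in>{..<\<delta>}. \<not> (\<exists>c\<in>C i. \<nu> i < c \<and> c < g i)} \<in> small J)"
    using step_above[of \<C>] K C by blast
  then obtain G where "\<forall>\<nu>. \<nu> \<in> ?\<Pi> \<longrightarrow> G \<nu> \<in> ?\<Pi> \<and> (\<forall>C\<in>\<C>.
      {i\<in>{..<\<delta>}. \<not> (\<exists>c\<in>C i. \<nu> i < c \<and> c < G \<nu> i)} \<in> small J)"
    by (rule choice[THEN exE])
  then have G: "\<And>\<nu>. \<nu> \<in> ?\<Pi> \<Longrightarrow> G \<nu> \<in> ?\<Pi>"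
    "\<And>\<nu> C. \<nu> \<in> ?\<Pi> \<Longrightarrow> C \<in> \<C> \<Longrightarrow> {i\<in>{..<\<delta>}. \<not> (\<exists>c\<in>C i. \<nu> i < c \<and> c < G \<nu> i)} \<in> small J"
    by simp_all
  define P where "P f \<epsilon> r \<longleftrightarrow> (\<epsilon> < \<sigma> \<longrightarrow> r \<in> ?\<Pi> \<and>
      (\<forall>\<zeta><\<epsilon>. \<forall>i<\<delta>. f \<zeta> i < r i \<and> G (f \<zeta>) i < r i))" for f \<epsilon> r
  have "\<exists>\<nu>. \<forall>\<epsilon>. P \<nu> \<epsilon> (\<nu> \<epsilon>)"
  proof (rule dependent_wellorder_choice)
    fix r :: "'a \<Rightarrow> 'a" and f g :: "'a \<Rightarrow> 'a \<Rightarrow> 'a" and x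
    assume "\<And>y. y < x \<Longrightarrow> f y = g y"
    then show "P f x r = P g x r" unfolding P_def by simp
  next
    fix f :: "'a \<Rightarrow> 'a \<Rightarrow> 'a" and \<epsilon> assume IH: "\<And>\<zeta>. \<zeta> < \<epsilon> \<Longrightarrow> P f \<zeta> (f \<zeta>)"
    show "\<exists>r. P f \<epsilon> r"
    proof (cases "\<epsilon> < \<sigma>")
      case \<epsilon>: True
      have in\<Pi>: "f \<zeta> \<in> ?\<Pi>" "G (f \<zeta>) \<in> ?\<Pi>" if "\<zeta> < \<epsilon>" for \<zeta>
        using IH[OF that] that \<epsilon> G(1) unfolding P_def by auto
      have "\<exists>y<lams i. \<forall>\<zeta><\<epsilon>. max (f \<zeta> i) (G (f \<zeta>) i) < y" if i: "i < \<delta>" for i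
      proof -
        have "{..<\<epsilon>} \<prec> {..<lams i}"
          using lams_regular[OF i] \<sigma>_less[OF i] \<epsilon> unfolding regular_cardinal_def cardinal_def
          by (meson less_trans)
        moreover have "max (f \<zeta> i) (G (f \<zeta>) i) < lams i" if "\<zeta> \<in> {..<\<epsilon>}" for \<zeta>
          using in\<Pi>[of \<zeta>] that i by (auto simp: PiE_iff)
        ultimately show ?thesis
          using regular_bounded[OF lams_regular[OF i], of "{..<\<epsilon>}" "\<lambda>\<zeta>. max (f \<zeta> i) (G (f \<zeta>) i)"]
          by auto
      qed
      then obtain r where r: "\<And>i. i < \<delta> \<Longrightarrow> r i < lams i \<and> (\<forall>\<zeta><\<epsilon>. max (f \<zeta> i) (G (f \<zeta>) i) < r i)"
        by metis
      have "P f \<epsilon> (restrict r {..<\<delta>})" unfolding P_def using r by auto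
      then show ?thesis by blast
    qed (auto simp: P_def)
  qed
  then obtain \<nu> where "\<And>\<epsilon>. P \<nu> \<epsilon> (\<nu> \<epsilon>)" by blast
  then have \<nu>: "\<And>\<epsilon>. \<epsilon> < \<sigma> \<Longrightarrow> \<nu> \<epsilon> \<in> ?\<Pi>"
    "\<And>\<epsilon> \<zeta> i. \<epsilon> < \<sigma> \<Longrightarrow> \<zeta> < \<epsilon> \<Longrightarrow> i < \<delta> \<Longrightarrow> \<nu> \<zeta> i < \<nu> \<epsilon> i \<and> G (\<nu> \<zeta>) i < \<nu> \<epsilon> i"
    unfolding P_def by auto
  define \<eta> where "\<eta> = (\<lambda>i\<in>{..<\<delta>}. LEAST y. \<forall>\<epsilon><\<sigma>. \<nu> \<epsilon> i < y)"
  have below: "\<eta> i < lams i \<and> (\<forall>\<epsilon><\<sigma>. \<nu> \<epsilon> i < \<eta> i)" if i: "i < \<delta>" for i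
  proof -
    have "{..<\<sigma>} \<prec> {..<lams i}"
      using lams_regular[OF i] \<sigma>_less[OF i] unfolding regular_cardinal_def cardinal_def by blast
    from regular_bounded[OF lams_regular[OF i] this, of "\<lambda>\<epsilon>. \<nu> \<epsilon> i"] \<nu>(1) i
    obtain y where y: "y < lams i" "\<forall>\<epsilon><\<sigma>. \<nu> \<epsilon> i < y" by (auto simp: PiE_iff)
    have "\<eta> i \<le> y" unfolding \<eta>_def using y i by (simp add: Least_le)
    moreover have "\<forall>\<epsilon><\<sigma>. \<nu> \<epsilon> i < \<eta> i"
      unfolding \<eta>_def using LeastI[of "\<lambda>y. \<forall>\<epsilon><\<sigma>. \<nu> \<epsilon> i < y", OF y(2)] i by simp
    ultimately show ?thesis using y(1) by auto
  qed
  have cof: "\<exists>\<epsilon><\<sigma>. y \<le> \<nu> \<epsilon> i" if "y < \<eta> i" "i < \<delta>" for y i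
    using not_less_Least[of y "\<lambda>y. \<forall>\<epsilon><\<sigma>. \<nu> \<epsilon> i < y"] that unfolding \<eta>_def by (auto simp: not_less)
  have cof2: "\<exists>\<epsilon><\<sigma>. y < \<nu> \<epsilon> i" if y: "y < \<eta> i" "i < \<delta>" for y i
  proof -
    from cof[OF y] obtain \<epsilon> where \<epsilon>: "\<epsilon> < \<sigma>" "y \<le> \<nu> \<epsilon> i" by blast
    obtain \<epsilon>' where "\<epsilon>' < \<sigma>" "\<epsilon> < \<epsilon>'" using regular_above[OF \<sigma>_regular \<epsilon>(1)] by blast
    with \<nu>(2)[OF this y(2)] \<epsilon> show ?thesis by (meson le_less_trans)
  qed
  have cf: "cf (\<eta> i) = \<sigma>" if "i < \<delta>" for i
    using \<sigma>_regular
    by (rule cf_sup_increasing[where \<nu> = "\<lambda>\<epsilon>. \<nu> \<epsilon> i"]) (use \<nu>(2) below cof that in auto)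
  have "\<exists>\<epsilon>. \<epsilon> < \<sigma>" using \<sigma>_regular unfolding regular_cardinal_def
    by (metis ex_in_conv finite.emptyI lessThan_iff)
  then have lim: "limit_ord (\<eta> i)" if "i < \<delta>" for i
    using below cof2 that unfolding limit_ord_def by blast
  have "{i\<in>{..<\<delta>}. \<eta> i \<notin> C i} \<in> small J" if CC: "C \<in> \<C>" for C
  proof -
    let ?B = "{i\<in>{..<\<delta>}. \<eta> i \<notin> C i}"
    have "\<exists>\<epsilon><\<sigma>. \<forall>c\<in>C i. \<nu> \<epsilon> i \<le> c \<longrightarrow> \<eta> i < c" if i: "i \<in> ?B" for i
    proof -
      have i': "i < \<delta>" "\<eta> i \<notin> C i" using i by auto
      from club_gap[OF C[OF CC i'(1)] _ lim[OF i'(1)] i'(2)] below[OF i'(1)]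
      obtain x where x: "x < \<eta> i" "\<forall>c\<in>C i. x \<le> c \<longrightarrow> \<eta> i < c" by blast
      then show ?thesis using cof[OF x(1) i'(1)] by (meson order_trans)
    qed
    then obtain h where h: "\<And>i. i \<in> ?B \<Longrightarrow> h i < \<sigma> \<and> (\<forall>c\<in>C i. \<nu> (h i) i \<le> c \<longrightarrow> \<eta> i < c)"
      by metis
    have "?B \<lesssim> {..<\<delta>}" by (rule subset_imp_lepoll) auto
    then have "?B \<prec> {..<\<sigma>}" using \<delta>_less_\<sigma> lesspoll_trans1 by blast
    from regular_bounded[OF \<sigma>_regular this, of h] h
    obtain \<epsilon> where \<epsilon>: "\<epsilon> < \<sigma>" "\<forall>i\<in>?B. h i < \<epsilon>" by blast
    obtain \<epsilon>' where \<epsilon>': "\<epsilon>' < \<sigma>" "\<epsilon> < \<epsilon>'" using regular_above[OF \<sigma>_regular \<epsilon>(1)] by blast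
    have "?B \<subseteq> {i\<in>{..<\<delta>}. \<not> (\<exists>c\<in>C i. \<nu> \<epsilon> i < c \<and> c < G (\<nu> \<epsilon>) i)}"
    proof
      fix i assume iB: "i \<in> ?B"
      then have i: "i < \<delta>" by simp
      have "\<not> (\<nu> \<epsilon> i < c \<and> c < G (\<nu> \<epsilon>) i)" if c: "c \<in> C i" for c
      proof
        assume gap: "\<nu> \<epsilon> i < c \<and> c < G (\<nu> \<epsilon>) i"
        have "\<nu> (h i) i < \<nu> \<epsilon> i" using \<nu>(2) \<epsilon> iB i by blast
        then have "\<eta> i < c" using h[OF iB] c gap by auto
        moreover have "G (\<nu> \<epsilon>) i < \<nu> \<epsilon>' i" using \<nu>(2)[OF \<epsilon>' i] by simp
        ultimately show False using gap below[OF i] \<epsilon>'(1) by (meson less_asym less_trans)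
      qed
      then show "i \<in> {i\<in>{..<\<delta>}. \<not> (\<exists>c\<in>C i. \<nu> \<epsilon> i < c \<and> c < G (\<nu> \<epsilon>) i)}" using i by blast
    qed
    then show ?thesis using J_subset[OF G(2)[OF \<nu>(1)[OF \<epsilon>(1)] CC]] by blast
  qed
  moreover have "\<eta> \<in> ?\<Pi>" using below unfolding \<eta>_def by (auto simp: PiE_iff)
  ultimately show ?thesis using cf by blast
qed

end

section \<open>Club systems and iterated quantifiers\<close>

text \<open>A failure of \<open>\<exists>\<^sup>+x\<^sub>0 \<dots> \<exists>\<^sup>+x\<^sub>n\<^sub>-\<^sub>1\<close> over nonstationary ideals is witnessed by a strategy \<open>S\<close>: a club for
  \<open>x\<^sub>0\<close>, then for each choice of \<open>x\<^sub>0\<close> a club for \<open>x\<^sub>1\<close>, and so on. The argument of \<open>S\<close> is the list of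
  earlier entries.\<close>

definition obeys :: "('x list \<Rightarrow> 'x set) \<Rightarrow> 'x list \<Rightarrow> bool" where
  "obeys S xs \<longleftrightarrow> (\<forall>l<length xs. xs ! l \<in> S (take l xs))"

lemma obeys_Nil [simp]: "obeys S []"
  by (simp add: obeys_def)

lemma obeys_Cons: "obeys S (x # xs) \<longleftrightarrow> x \<in> S [] \<and> obeys (\<lambda>ys. S (x # ys)) xs"
  by (auto simp: obeys_def less_Suc_eq_0_disj)

lemma obeys_mono: "obeys S xs \<Longrightarrow> (\<And>ys. S ys \<subseteq> S' ys) \<Longrightarrow> obeys S' xs"
  unfolding obeys_def by blast

lemma obeys_club_subset:
  assumes "obeys S xs" and "\<And>ys. club \<chi> (S ys)"
  shows "set xs \<subseteq> {..<\<chi>}"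
  using assms club_below unfolding obeys_def by (metis in_set_conv_nth lessThan_iff subsetI)

lemma ex_pos_avoid:
  "\<not> ex_pos (replicate n (J_nst \<sigma> \<chi>)) \<phi> \<Longrightarrow> regular_cardinal \<chi> \<Longrightarrow>
    \<exists>S. (\<forall>ys. club \<chi> (S ys)) \<and>
      (\<forall>xs. length xs = n \<and> (\<forall>x\<in>set xs. cf x = \<sigma>) \<and> obeys S xs \<longrightarrow> \<not> \<phi> xs)"
proof (induction n arbitrary: \<phi>)
  case 0
  then show ?case using club_lessThan[of \<chi>] by (intro exI[of _ "\<lambda>_. {..<\<chi>}"]) simp
next
  case (Suc n)
  let ?Y = "{x \<in> Dom (J_nst \<sigma> \<chi>). ex_pos (replicate n (J_nst \<sigma> \<chi>)) (\<lambda>xs. \<phi> (x # xs))}"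
  have "?Y \<notin> pos (J_nst \<sigma> \<chi>)" using Suc.prems by simp
  then have "\<not> stationary \<chi> {\<alpha>\<in>?Y. cf \<alpha> = \<sigma>}" unfolding pos_def J_nst_def by auto
  then obtain C where C: "club \<chi> C" "{\<alpha>\<in>?Y. cf \<alpha> = \<sigma>} \<inter> C = {}"
    unfolding stationary_def J_nst_def by auto
  have "\<exists>S. (\<forall>ys. club \<chi> (S ys)) \<and> (x \<in> C \<and> cf x = \<sigma> \<longrightarrow>
      (\<forall>xs. length xs = n \<and> (\<forall>x\<in>set xs. cf x = \<sigma>) \<and> obeys S xs \<longrightarrow> \<not> \<phi> (x # xs)))" for x
  proof (cases "x \<in> C \<and> cf x = \<sigma>")
    case True
    then have "x \<notin> ?Y" "x < \<chi>" using C club_below by blast+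
    then have "\<not> ex_pos (replicate n (J_nst \<sigma> \<chi>)) (\<lambda>xs. \<phi> (x # xs))" by (simp add: J_nst_def)
    from Suc.IH[OF this Suc.prems(2)] show ?thesis by blast
  next
    case False
    then show ?thesis using club_lessThan[OF Suc.prems(2)] by (intro exI[of _ "\<lambda>_. {..<\<chi>}"]) blast
  qed
  then obtain T where T: "\<And>x ys. club \<chi> (T x ys)"
    "\<And>x xs. x \<in> C \<Longrightarrow> cf x = \<sigma> \<Longrightarrow> length xs = n \<Longrightarrow> \<forall>x\<in>set xs. cf x = \<sigma> \<Longrightarrow>
      obeys (T x) xs \<Longrightarrow> \<not> \<phi> (x # xs)" by metis
  define S where "S ys = (case ys of [] \<Rightarrow> C | x # ys' \<Rightarrow> T x ys')" for ys
  have "club \<chi> (S ys)" for ys unfolding S_def using C T by (simp split: list.split)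
  moreover have "\<not> \<phi> xs"
    if xs: "length xs = Suc n" "\<forall>x\<in>set xs. cf x = \<sigma>" "obeys S xs" for xs
  proof -
    obtain x xs' where x: "xs = x # xs'" using xs(1) by (cases xs) auto
    show ?thesis using T(2)[of x xs'] xs unfolding x by (auto simp: obeys_Cons S_def)
  qed
  ultimately show ?case by blast
qed

lemma singleton_pos_iff:
  "(\<lambda>x. [x]) ` Y \<in> pos (prod_idl [I]) \<longleftrightarrow> Y \<in> pos I"
proof -
  have "{x \<in> Dom I. [x] \<in> (\<lambda>x. [x]) ` Y} = Y" if "Y \<subseteq> Dom I" using that by auto
  moreover have "(\<lambda>x. [x]) ` Y \<subseteq> tuples [I] \<longleftrightarrow> Y \<subseteq> Dom I" by (auto simp: tuples_def)
  ultimately show ?thesis by (auto simp: pos_def prod_idl_def)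
qed

lemma pos_prod_idl_iff: "X \<in> pos (prod_idl Is) \<longleftrightarrow> X \<subseteq> tuples Is \<and> ex_pos Is (\<lambda>xs. xs \<in> X)"
  by (auto simp: pos_def prod_idl_def)

section \<open>A sequence that obeys every club system\<close>

locale coded_scale = scale +
  fixes \<mu> :: "'a::wellorder"
  assumes \<mu>_infinite: "infinite {..<\<mu>}"
    and lam_Pow: "{..<lam} \<approx> Pow {..<\<mu>}"
    and \<delta>_le: "\<delta> \<le> \<mu>" and lams_le: "i < \<delta> \<Longrightarrow> lams i \<le> \<mu>"
    and lams_mono: "i < j \<Longrightarrow> j < \<delta> \<Longrightarrow> lams i < lams j"
begin

definition club_system :: "('a \<Rightarrow> 'a list \<Rightarrow> 'a set) \<Rightarrow> bool" where
  "club_system S \<longleftrightarrow> (\<forall>i<\<delta>. \<forall>ys. club (lams i) (S i ys))"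

text \<open>A club system is coded by the set of lists \<open>i # c # ys\<close> with \<open>c \<in> S i ys\<close>, a subset of
  \<open>lists {..<\<mu>}\<close>; there are \<open>2\<^sup>\<mu> = \<lambda>\<close> of these. A code that does not yield a club is read as
  the whole of \<open>lams i\<close>, so that every \<open>\<gamma>\<close> enumerates a club system.\<close>

lemma club_system_enumeration:
  "\<exists>D. (\<forall>\<gamma>. club_system (D \<gamma>)) \<and>
     (\<forall>S. club_system S \<longrightarrow> (\<exists>\<gamma><lam. \<forall>i<\<delta>. \<forall>ys\<in>lists {..<\<mu>}. D \<gamma> i ys = S i ys))"
proof -
  have "Pow (lists {..<\<mu>}) \<lesssim> {..<lam}"
  proof -
    obtain f where f: "inj_on f (lists {..<\<mu>})" "f ` lists {..<\<mu>} \<subseteq> {..<\<mu>}"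
      using lists_lepoll_self[OF \<mu>_infinite] unfolding lepoll_def by blast
    then have "inj_on (image f) (Pow (lists {..<\<mu>}))" using inj_on_image_Pow by blast
    moreover have "image f ` Pow (lists {..<\<mu>}) \<subseteq> Pow {..<\<mu>}" using f(2) by blast
    ultimately have "Pow (lists {..<\<mu>}) \<lesssim> Pow {..<\<mu>}" unfolding lepoll_def by blast
    then show ?thesis using lam_Pow eqpoll_sym lepoll_trans2 by blast
  qed
  then obtain e where e: "Pow (lists {..<\<mu>}) \<subseteq> e ` {..<lam}" unfolding lepoll_iff by blast
  define D where "D \<gamma> i ys =
    (if club (lams i) {c. i # c # ys \<in> e \<gamma>} then {c. i # c # ys \<in> e \<gamma>} else {..<lams i})" for \<gamma> i ys
  have "club_system (D \<gamma>)" for \<gamma>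
    unfolding club_system_def D_def by (simp add: club_lessThan lams_regular)
  moreover have "\<exists>\<gamma><lam. \<forall>i<\<delta>. \<forall>ys\<in>lists {..<\<mu>}. D \<gamma> i ys = S i ys" if S: "club_system S" for S
  proof -
    define T where "T = {i # c # ys | i c ys. i < \<delta> \<and> ys \<in> lists {..<\<mu>} \<and> c \<in> S i ys}"
    have below: "c < \<mu>" if "i < \<delta>" "c \<in> S i ys" for i c ys
      using S that club_below lams_le unfolding club_system_def by (meson less_le_trans)
    have "T \<subseteq> lists {..<\<mu>}"
    proof
      fix zs assume "zs \<in> T"
      then obtain i c ys where zs: "zs = i # c # ys" "i < \<delta>" "ys \<in> lists {..<\<mu>}" "c \<in> S i ys"
        unfolding T_def by blast
      then have "i < \<mu>" "c < \<mu>" using \<delta>_le below by (blast intro: less_le_trans)+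
      then show "zs \<in> lists {..<\<mu>}" using zs by simp
    qed
    then have "T \<in> e ` {..<lam}" using e by blast
    then obtain \<gamma> where \<gamma>: "\<gamma> < lam" "e \<gamma> = T" by blast
    have "D \<gamma> i ys = S i ys" if "i < \<delta>" "ys \<in> lists {..<\<mu>}" for i ys
    proof -
      have "{c. i # c # ys \<in> e \<gamma>} = S i ys" using that unfolding \<gamma> T_def by blast
      then show ?thesis using S that unfolding D_def club_system_def by simp
    qed
    then show ?thesis using \<gamma>(1) by blast
  qed
  ultimately show ?thesis by blast
qed

lemma \<mu>_less: "\<mu> < lam"
proof (rule ccontr)
  assume "\<not> \<mu> < lam"
  then have "{..<lam} \<lesssim> {..<\<mu>}" by (intro subset_imp_lepoll) auto
  then have "{..<lam} \<prec> Pow {..<\<mu>}" using lesspoll_Pow_self lesspoll_trans1 by blast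
  then show False using lam_Pow unfolding lesspoll_def by blast
qed

text \<open>The function \<open>\<eta> \<alpha>\<close> is chosen, given the earlier ones, to meet the clubs that the first \<open>\<alpha>\<close>
  club systems assign to all finite tuples of earlier values. These are fewer than \<open>\<lambda>\<close> sequences of
  clubs. Against a given system, enumerated at stage \<open>\<gamma>\<close>, every increasing tuple above \<open>\<gamma>\<close> then
  fails to obey only on a finite union of sets in \<open>J\<close>.\<close>

lemma generic_sequence:
  "\<exists>\<eta>. (\<forall>\<alpha><lam. \<eta> \<alpha> \<in> (\<Pi>\<^sub>E i\<in>{..<\<delta>}. {..<lams i}) \<and> (\<forall>i<\<delta>. cf (\<eta> \<alpha> i) = \<sigma>)) \<and>
     (\<forall>S. club_system S \<longrightarrow> (\<exists>\<gamma><lam. \<forall>bs. sorted_wrt (<) bs \<and> set bs \<subseteq> {\<gamma><..<lam} \<longrightarrow>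
        {i\<in>{..<\<delta>}. \<not> obeys (S i) (map (\<lambda>b. \<eta> b i) bs)} \<in> small J))"
proof -
  let ?\<Pi> = "\<Pi>\<^sub>E i\<in>{..<\<delta>}. {..<lams i}"
  obtain D where D: "\<And>\<gamma>. club_system (D \<gamma>)"
    "\<And>S. club_system S \<Longrightarrow> \<exists>\<gamma><lam. \<forall>i<\<delta>. \<forall>ys\<in>lists {..<\<mu>}. D \<gamma> i ys = S i ys"
    using club_system_enumeration by metis
  define P where "P f \<alpha> r \<longleftrightarrow> (\<alpha> < lam \<longrightarrow> r \<in> ?\<Pi> \<and> (\<forall>i<\<delta>. cf (r i) = \<sigma>) \<and>
    (\<forall>\<gamma><\<alpha>. \<forall>bs\<in>lists {..<\<alpha>}. {i\<in>{..<\<delta>}. r i \<notin> D \<gamma> i (map (\<lambda>b. f b i) bs)} \<in> small J))"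
    for f :: "'a \<Rightarrow> 'a \<Rightarrow> 'a" and \<alpha> r
  have "\<exists>\<eta>. \<forall>\<alpha>. P \<eta> \<alpha> (\<eta> \<alpha>)"
  proof (rule dependent_wellorder_choice)
    fix r :: "'a \<Rightarrow> 'a" and f g :: "'a \<Rightarrow> 'a \<Rightarrow> 'a" and x
    assume eq: "\<And>y. y < x \<Longrightarrow> f y = g y"
    have "map (\<lambda>b. f b i) bs = map (\<lambda>b. g b i) bs" if "bs \<in> lists {..<x}" for bs i
      using eq that by (auto simp: lists_eq_set)
    then show "P f x r = P g x r" unfolding P_def by (simp only: cong: ball_cong)
  next
    fix f :: "'a \<Rightarrow> 'a \<Rightarrow> 'a" and \<alpha>
    show "\<exists>r. P f \<alpha> r"
    proof (cases "\<alpha> < lam")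
      case \<alpha>: True
      \<comment> \<open>The pair \<open>(\<gamma>, bs)\<close> is packed into the list \<open>\<gamma> # bs\<close>. The maximum with \<open>\<mu>\<close> makes the
        alphabet infinite, so that there are no more lists than letters.\<close>
      let ?c = "\<lambda>zs i. D (hd zs) i (map (\<lambda>b. f b i) (tl zs))"
      let ?K = "lists {..<max \<alpha> \<mu>}"
      have "infinite {..<max \<alpha> \<mu>}" using \<mu>_infinite by (auto simp: max_def)
          (meson finite_subset less_imp_le not_le lessThan_subset_iff)
      then have "?K \<lesssim> {..<max \<alpha> \<mu>}" by (rule lists_lepoll_self)
      moreover have "{..<max \<alpha> \<mu>} \<prec> {..<lam}"
        using lam_regular \<alpha> \<mu>_less unfolding regular_cardinal_def cardinal_def by auto
      ultimately have "?c ` ?K \<prec> {..<lam}"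
        using image_lepoll lepoll_trans lesspoll_trans1 by blast
      moreover have "club (lams i) (C i)" if "C \<in> ?c ` ?K" "i < \<delta>" for C i
        using that D(1) unfolding club_system_def by auto
      ultimately have "\<exists>r\<in>?\<Pi>. (\<forall>i<\<delta>. cf (r i) = \<sigma>) \<and>
          (\<forall>C\<in>?c ` ?K. {i\<in>{..<\<delta>}. r i \<notin> C i} \<in> small J)"
        by (rule generic_function)
      then obtain r where r: "r \<in> ?\<Pi>" "\<forall>i<\<delta>. cf (r i) = \<sigma>"
        and avoid: "\<forall>C\<in>?c ` ?K. {i\<in>{..<\<delta>}. r i \<notin> C i} \<in> small J" by (elim bexE conjE)
      have "{i\<in>{..<\<delta>}. r i \<notin> D \<gamma> i (map (\<lambda>b. f b i) bs)} \<in> small J"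
        if "\<gamma> < \<alpha>" "bs \<in> lists {..<\<alpha>}" for \<gamma> bs
      proof -
        have "\<gamma> # bs \<in> ?K" using that by (auto simp: lists_eq_set less_max_iff_disj)
        from bspec[OF avoid imageI[OF this]] show ?thesis by simp
      qed
      then have "P f \<alpha> r" unfolding P_def using r by blast
      then show ?thesis by blast
    qed (auto simp: P_def)
  qed
  then obtain \<eta> where "\<And>\<alpha>. P \<eta> \<alpha> (\<eta> \<alpha>)" by blast
  then have \<eta>: "\<And>\<alpha>. \<alpha> < lam \<Longrightarrow> \<eta> \<alpha> \<in> ?\<Pi> \<and> (\<forall>i<\<delta>. cf (\<eta> \<alpha> i) = \<sigma>)"
    "\<And>\<alpha> \<gamma> bs. \<alpha> < lam \<Longrightarrow> \<gamma> < \<alpha> \<Longrightarrow> bs \<in> lists {..<\<alpha>} \<Longrightarrow>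
      {i\<in>{..<\<delta>}. \<eta> \<alpha> i \<notin> D \<gamma> i (map (\<lambda>b. \<eta> b i) bs)} \<in> small J"
    unfolding P_def by blast+
  have "\<exists>\<gamma><lam. \<forall>bs. sorted_wrt (<) bs \<and> set bs \<subseteq> {\<gamma><..<lam} \<longrightarrow>
      {i\<in>{..<\<delta>}. \<not> obeys (S i) (map (\<lambda>b. \<eta> b i) bs)} \<in> small J" if S: "club_system S" for S
  proof -
    from D(2)[OF S] obtain \<gamma> where \<gamma>: "\<gamma> < lam"
      "\<And>i ys. i < \<delta> \<Longrightarrow> ys \<in> lists {..<\<mu>} \<Longrightarrow> D \<gamma> i ys = S i ys" by blast
    have "{i\<in>{..<\<delta>}. \<not> obeys (S i) (map (\<lambda>b. \<eta> b i) bs)} \<in> small J"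
      if bs: "sorted_wrt (<) bs" "set bs \<subseteq> {\<gamma><..<lam}" for bs
    proof -
      let ?E = "\<lambda>l. {i\<in>{..<\<delta>}. \<eta> (bs ! l) i \<notin> D \<gamma> i (map (\<lambda>b. \<eta> b i) (take l bs))}"
      have "?E l \<in> small J" if l: "l < length bs" for l
      proof (rule \<eta>(2))
        have "bs ! l \<in> {\<gamma><..<lam}" using bs(2) l by (meson nth_mem subsetD)
        then show "bs ! l < lam" "\<gamma> < bs ! l" by auto
        show "take l bs \<in> lists {..<bs ! l}"
          using sorted_wrt_nth_less[OF bs(1) _ l] l by (auto simp: lists_eq_set in_set_conv_nth)
      qed
      then have "(\<Union>l\<in>{..<length bs}. ?E l) \<in> small J" by (intro J_finite_UN) auto
      moreover have "{i\<in>{..<\<delta>}. \<not> obeys (S i) (map (\<lambda>b. \<eta> b i) bs)} \<subseteq> (\<Union>l\<in>{..<length bs}. ?E l)"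
      proof
        fix i assume "i \<in> {i\<in>{..<\<delta>}. \<not> obeys (S i) (map (\<lambda>b. \<eta> b i) bs)}"
        then obtain l where i: "i < \<delta>" and l: "l < length bs"
          "\<eta> (bs ! l) i \<notin> S i (map (\<lambda>b. \<eta> b i) (take l bs))"
          by (auto simp: obeys_def take_map)
        have "\<eta> b i < \<mu>" if b: "b \<in> set bs" for b
        proof -
          have "b < lam" using b bs(2) by auto
          then have "\<eta> b i < lams i" using \<eta>(1) i by (auto simp: PiE_iff)
          then show ?thesis using lams_le[OF i] by (rule less_le_trans)
        qed
        then have "map (\<lambda>b. \<eta> b i) (take l bs) \<in> lists {..<\<mu>}"
          by (auto simp: lists_eq_set dest: in_set_takeD)
        then have "i \<in> ?E l" using \<gamma>(2)[OF i] i l by simp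
        then show "i \<in> (\<Union>l\<in>{..<length bs}. ?E l)" using l by blast
      qed
      ultimately show ?thesis by (rule J_subset)
    qed
    then show ?thesis using \<gamma>(1) by blast
  qed
  then show ?thesis using \<eta>(1) by blast
qed

section \<open>Tuples over several coordinates\<close>

lemma lams_lesspoll: "x < lams i \<Longrightarrow> i < \<delta> \<Longrightarrow> {..<x} \<prec> {..<lams i}"
  using lams_regular unfolding regular_cardinal_def cardinal_def by blast

lemma nat_lesspoll_lams:
  assumes "i < \<delta>" shows "(UNIV :: nat set) \<prec> {..<lams i}"
  using lams_lesspoll[OF \<sigma>_less] assms \<sigma>_regular unfolding regular_cardinal_def
  by (metis infinite_le_lepoll lesspoll_trans1)

lemma lists_\<delta>_lesspoll:
  assumes "i < \<delta>" shows "lists {..<\<delta>} \<prec> {..<lams i}"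
proof -
  have "lists {..<\<delta>} \<lesssim> lists {..<\<sigma>}"
    using \<delta>_less_\<sigma> by (intro lists_lepoll_mono lesspoll_imp_lepoll)
  also have "lists {..<\<sigma>} \<lesssim> {..<\<sigma>}"
    using \<sigma>_regular by (intro lists_lepoll_self) (simp add: regular_cardinal_def)
  finally show ?thesis using lams_lesspoll[OF \<sigma>_less] assms lesspoll_trans1 by blast
qed

lemma lists_lams_lesspoll:
  assumes "i < j" "j < \<delta>" shows "lists {..<lams i} \<prec> {..<lams j}"
  using lists_lepoll_self lams_regular[of i] lams_lesspoll[OF lams_mono] assms
  unfolding regular_cardinal_def by (meson less_trans lesspoll_trans1)

text \<open>In the iterated product, the clubs at coordinate \<open>j\<close> depend on whole tuples at the smaller
  coordinates \<open>i\<close>. Such a dependence is harmful: in the intended application the later entries of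
  these tuples come from later members of the sequence than the entry at \<open>j\<close> under consideration,
  which a recursion cannot anticipate. But \<open>lams i < lams j\<close>, so there are
  fewer than \<open>lams j\<close> tuples at coordinate \<open>i\<close>, and intersecting over them leaves clubs that
  depend only on the entries at \<open>j\<close> itself: a single club system suffices.\<close>

lemma prod_avoid:
  "\<not> ex_pos (map (\<lambda>i. prod_idl (replicate n (J_nst \<sigma> (lams i)))) is) \<phi> \<Longrightarrow>
    sorted_wrt (<) is \<Longrightarrow> set is \<subseteq> {..<\<delta>} \<Longrightarrow>
    \<exists>S. club_system S \<and> (\<forall>xss. list_all2
      (\<lambda>i xs. length xs = n \<and> (\<forall>x\<in>set xs. cf x = \<sigma>) \<and> obeys (S i) xs) is xss \<longrightarrow> \<not> \<phi> xss)"
proof (induction "is" arbitrary: \<phi>)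
  case Nil
  then show ?case
    by (intro exI[of _ "\<lambda>i _. {..<lams i}"]) (simp add: club_system_def club_lessThan lams_regular)
next
  case (Cons i "is")
  let ?P = "\<lambda>i. prod_idl (replicate n (J_nst \<sigma> (lams i)))"
  have i: "i < \<delta>" and gt: "\<And>j. j \<in> set is \<Longrightarrow> i < j" and lt: "\<And>j. j \<in> set is \<Longrightarrow> j < \<delta>"
    using Cons.prems by auto
  let ?Y = "{x \<in> Dom (?P i). ex_pos (map ?P is) (\<lambda>xss. \<phi> (x # xss))}"
  have "?Y \<notin> pos (?P i)" using Cons.prems by simp
  then have "\<not> ex_pos (replicate n (J_nst \<sigma> (lams i))) (\<lambda>xs. xs \<in> ?Y)"
    unfolding pos_prod_idl_iff by (auto simp: prod_idl_def)
  from ex_pos_avoid[OF this lams_regular[OF i]] obtain S0 where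
    S0: "\<And>ys. club (lams i) (S0 ys)"
      "\<And>xs. length xs = n \<Longrightarrow> \<forall>x\<in>set xs. cf x = \<sigma> \<Longrightarrow> obeys S0 xs \<Longrightarrow> xs \<notin> ?Y" by blast
  let ?K = "Dom (?P i) - ?Y"
  have "\<forall>x\<in>?K. \<exists>S. club_system S \<and> (\<forall>xss. list_all2
      (\<lambda>i xs. length xs = n \<and> (\<forall>x\<in>set xs. cf x = \<sigma>) \<and> obeys (S i) xs) is xss \<longrightarrow> \<not> \<phi> (x # xss))"
    using Cons.IH Cons.prems by auto
  from bchoice[OF this] obtain T where T: "\<And>x. x \<in> ?K \<Longrightarrow> club_system (T x)"
    "\<And>x xss. x \<in> ?K \<Longrightarrow> list_all2
      (\<lambda>i xs. length xs = n \<and> (\<forall>x\<in>set xs. cf x = \<sigma>) \<and> obeys (T x i) xs) is xss \<Longrightarrow> \<not> \<phi> (x # xss)"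
    by blast
  have Dom: "Dom (?P i) = {xs. length xs = n \<and> set xs \<subseteq> {..<lams i}}"
    by (auto simp: prod_idl_def tuples_def J_nst_def in_set_conv_nth subset_iff)
  define S where "S j ys = (if j = i then S0 ys
    else if i < j then {..<lams j} \<inter> (\<Inter>x\<in>?K. T x j ys) else {..<lams j})" for j ys
  have "club_system S" unfolding club_system_def
  proof (intro allI impI)
    fix j ys assume j: "j < \<delta>"
    show "club (lams j) (S j ys)"
    proof (cases "i < j")
      case True
      have "?K \<subseteq> lists {..<lams i}" unfolding Dom by (auto simp: lists_eq_set)
      then have "?K \<prec> {..<lams j}"
        using lists_lams_lesspoll[OF True j] subset_imp_lepoll lesspoll_trans1 by blast
      then have "club (lams j) ({..<lams j} \<inter> (\<Inter>x\<in>?K. T x j ys))"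
        using T(1) j unfolding club_system_def
        by (intro club_INT lams_regular nat_lesspoll_lams) auto
      moreover have "S j ys = {..<lams j} \<inter> (\<Inter>x\<in>?K. T x j ys)"
        using True less_imp_neq[OF True] unfolding S_def by simp
      ultimately show ?thesis by simp
    next
      case False
      then show ?thesis using S0(1) club_lessThan[OF lams_regular[OF j]] unfolding S_def by auto
    qed
  qed
  moreover have "\<not> \<phi> xss" if xss: "list_all2
      (\<lambda>i xs. length xs = n \<and> (\<forall>x\<in>set xs. cf x = \<sigma>) \<and> obeys (S i) xs) (i # is) xss" for xss
  proof -
    obtain x xss' where x: "xss = x # xss'" using xss by (cases xss) auto
    have "S i = S0" by (simp add: S_def fun_eq_iff)
    have hd: "length x = n" "\<forall>y\<in>set x. cf y = \<sigma>" "obeys S0 x"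
      using xss \<open>S i = S0\<close> unfolding x by auto
    have "x \<in> Dom (?P i)" unfolding Dom using hd obeys_club_subset S0(1) by blast
    then have xK: "x \<in> ?K" using S0(2) hd by blast
    have "list_all2
      (\<lambda>i xs. length xs = n \<and> (\<forall>x\<in>set xs. cf x = \<sigma>) \<and> obeys (S i) xs) is xss'"
      using xss unfolding x by simp
    then have "list_all2
      (\<lambda>i xs. length xs = n \<and> (\<forall>x\<in>set xs. cf x = \<sigma>) \<and> obeys (T x i) xs) is xss'"
    proof (rule list.rel_mono_strong)
      fix j xs assume "j \<in> set is" and
        o: "length xs = n \<and> (\<forall>x\<in>set xs. cf x = \<sigma>) \<and> obeys (S j) xs"
      then have "S j ys \<subseteq> T x j ys" for ys using gt xK unfolding S_def by auto
      then show "length xs = n \<and> (\<forall>x\<in>set xs. cf x = \<sigma>) \<and> obeys (T x j) xs"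
        using o obeys_mono by blast
    qed
    then show ?thesis using T(2)[OF xK] unfolding x by blast
  qed
  ultimately show ?case by blast
qed

text \<open>To obtain one exceptional set for all finite sequences of coordinates at once, the
  club systems refuting the bad sequences are intersected. There are at most \<open>\<sigma> < lams j\<close> bad sequences,
  so this is again a club system, and a single tuple \<open>\<beta> \<alpha>\<close> lying beyond its stage yields a set in \<open>J\<close>
  outside of which the tuple contradicts badness of any sequence.\<close>

lemma tuples_positive:
  fixes \<beta> :: "'a \<Rightarrow> nat \<Rightarrow> 'a"
  assumes \<eta>: "\<And>\<alpha>. \<alpha> < lam \<Longrightarrow> \<eta> \<alpha> \<in> (\<Pi>\<^sub>E i\<in>{..<\<delta>}. {..<lams i})"
      "\<And>\<alpha> i. \<alpha> < lam \<Longrightarrow> i < \<delta> \<Longrightarrow> cf (\<eta> \<alpha> i) = \<sigma>"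
    and gen: "\<And>S. club_system S \<Longrightarrow> \<exists>\<gamma><lam. \<forall>bs. sorted_wrt (<) bs \<and> set bs \<subseteq> {\<gamma><..<lam} \<longrightarrow>
        {i\<in>{..<\<delta>}. \<not> obeys (S i) (map (\<lambda>b. \<eta> b i) bs)} \<in> small J"
    and \<beta>: "\<forall>\<alpha><lam. \<forall>l<n. \<beta> \<alpha> l < lam"
      "inj_on (\<lambda>(\<alpha>, l). \<beta> \<alpha> l) ({..<lam} \<times> {..<n})"
      "\<forall>\<alpha><lam. strict_mono_on {..<n} (\<beta> \<alpha>)"
  shows "\<exists>A\<in>small J. \<forall>is. set is \<subseteq> {..<\<delta>} - A \<and> sorted_wrt (<) is \<longrightarrow>
    {map (\<lambda>i. map (\<lambda>l. \<eta> (\<beta> \<alpha> l) i) [0..<n]) is | \<alpha>. \<alpha> < lam}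
      \<in> pos (prod_idl (map (\<lambda>i. prod_idl (replicate n (J_nst \<sigma> (lams i)))) is))"
proof -
  let ?P = "\<lambda>i. prod_idl (replicate n (J_nst \<sigma> (lams i)))"
  let ?x = "\<lambda>is \<alpha>. map (\<lambda>i. map (\<lambda>l. \<eta> (\<beta> \<alpha> l) i) [0..<n]) is"
  let ?X = "\<lambda>is. {?x is \<alpha> | \<alpha>. \<alpha> < lam}"
  define F where "F = {is. set is \<subseteq> {..<\<delta>} \<and> sorted_wrt (<) is \<and>
    \<not> ex_pos (map ?P is) (\<lambda>xss. xss \<in> ?X is)}"
  have "\<forall>is\<in>F. \<exists>S. club_system S \<and> (\<forall>xss. list_all2
      (\<lambda>i xs. length xs = n \<and> (\<forall>x\<in>set xs. cf x = \<sigma>) \<and> obeys (S i) xs) is xss \<longrightarrow> xss \<notin> ?X is)"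
    using prod_avoid unfolding F_def by blast
  from bchoice[OF this] obtain T where T: "\<And>is. is \<in> F \<Longrightarrow> club_system (T is)"
    "\<And>is xss. is \<in> F \<Longrightarrow> list_all2
      (\<lambda>i xs. length xs = n \<and> (\<forall>x\<in>set xs. cf x = \<sigma>) \<and> obeys (T is i) xs) is xss \<Longrightarrow> xss \<notin> ?X is"
    by blast
  define S where "S j ys = {..<lams j} \<inter> (\<Inter>is\<in>F. T is j ys)" for j ys
  have "club_system S" unfolding club_system_def S_def
  proof (intro allI impI club_INT)
    fix j assume j: "j < \<delta>"
    have "F \<subseteq> lists {..<\<delta>}" unfolding F_def by (auto simp: lists_eq_set)
    then show "F \<prec> {..<lams j}"
      using lists_\<delta>_lesspoll[OF j] subset_imp_lepoll lesspoll_trans1 by blast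
  qed (use lams_regular nat_lesspoll_lams T(1) in \<open>auto simp: club_system_def\<close>)
  from gen[OF this] obtain \<gamma> where \<gamma>: "\<gamma> < lam"
    "\<And>bs. sorted_wrt (<) bs \<Longrightarrow> set bs \<subseteq> {\<gamma><..<lam} \<Longrightarrow>
      {i\<in>{..<\<delta>}. \<not> obeys (S i) (map (\<lambda>b. \<eta> b i) bs)} \<in> small J" by blast
  \<comment> \<open>The numbers \<open>\<beta> \<alpha> 0\<close> are \<open>\<lambda>\<close> many, so one of them exceeds \<open>\<gamma>\<close>.\<close>
  obtain \<alpha> where \<alpha>: "\<alpha> < lam" "\<And>l. l < n \<Longrightarrow> \<gamma> < \<beta> \<alpha> l"
  proof (cases "n = 0")
    case True
    then show ?thesis using that \<gamma>(1) by blast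
  next
    case False
    obtain \<gamma>' where \<gamma>': "\<gamma>' < lam" "\<gamma> < \<gamma>'" using regular_above[OF lam_regular \<gamma>(1)] by blast
    have "\<exists>\<alpha><lam. \<gamma> < \<beta> \<alpha> 0"
    proof (rule ccontr)
      assume "\<not> ?thesis"
      then have "(\<lambda>\<alpha>. \<beta> \<alpha> 0) ` {..<lam} \<subseteq> {..<\<gamma>'}" using \<gamma>' by force
      moreover have "inj_on (\<lambda>\<alpha>. \<beta> \<alpha> 0) {..<lam}"
        using \<beta>(2) False by (auto simp: inj_on_def)
      ultimately have "{..<lam} \<lesssim> {..<\<gamma>'}" unfolding lepoll_def by blast
      moreover have "{..<\<gamma>'} \<prec> {..<lam}"
        using lam_regular \<gamma>' unfolding regular_cardinal_def cardinal_def by blast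
      ultimately show False using lesspoll_trans1 lesspoll_not_refl by blast
    qed
    then obtain \<alpha> where \<alpha>: "\<alpha> < lam" "\<gamma> < \<beta> \<alpha> 0" by blast
    have "\<gamma> < \<beta> \<alpha> l" if "l < n" for l
    proof (cases "l = 0")
      case False
      then have "\<beta> \<alpha> 0 < \<beta> \<alpha> l" using \<beta>(3) \<alpha>(1) that by (auto simp: strict_mono_on_def)
      then show ?thesis using \<alpha>(2) by simp
    qed (use \<alpha> in simp)
    then show ?thesis using that \<alpha>(1) by blast
  qed
  let ?bs = "map (\<beta> \<alpha>) [0..<n]"
  let ?A = "{i\<in>{..<\<delta>}. \<not> obeys (S i) (map (\<lambda>b. \<eta> b i) ?bs)}"
  have "sorted_wrt (<) ?bs"
    using \<beta>(3) \<alpha>(1) by (auto simp: sorted_wrt_iff_nth_less strict_mono_on_def)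
  moreover have "set ?bs \<subseteq> {\<gamma><..<lam}" using \<alpha> \<beta>(1) by auto
  ultimately have "?A \<in> small J" by (rule \<gamma>(2))
  moreover have "?X is \<in> pos (prod_idl (map ?P is))"
    if js: "set is \<subseteq> {..<\<delta>} - ?A" "sorted_wrt (<) is" for "is"
  proof -
    have "is \<notin> F"
    proof
      assume F: "is \<in> F"
      have "list_all2
        (\<lambda>i xs. length xs = n \<and> (\<forall>x\<in>set xs. cf x = \<sigma>) \<and> obeys (T is i) xs) is (?x is \<alpha>)"
        unfolding list.rel_map
      proof (rule list.rel_refl_strong)
        fix i assume i: "i \<in> set is"
        then have "i < \<delta>" and o: "obeys (S i) (map (\<lambda>l. \<eta> (\<beta> \<alpha> l) i) [0..<n])"
          using js(1) by (auto simp: comp_def)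
        moreover have "S i ys \<subseteq> T is i ys" for ys unfolding S_def using F by blast
        ultimately show "length (map (\<lambda>l. \<eta> (\<beta> \<alpha> l) i) [0..<n]) = n \<and>
          (\<forall>x\<in>set (map (\<lambda>l. \<eta> (\<beta> \<alpha> l) i) [0..<n]). cf x = \<sigma>) \<and>
          obeys (T is i) (map (\<lambda>l. \<eta> (\<beta> \<alpha> l) i) [0..<n])"
          using \<eta>(2) \<beta>(1) \<alpha>(1) obeys_mono[OF o] by auto
      qed
      from T(2)[OF F this] show False using \<alpha>(1) by blast
    qed
    then have "ex_pos (map ?P is) (\<lambda>xss. xss \<in> ?X is)" using js unfolding F_def by blast
    moreover have "?X is \<subseteq> tuples (map ?P is)"
      using \<eta>(1) \<beta>(1) js(1)
      by (fastforce simp: tuples_def prod_idl_def J_nst_def PiE_iff dest: nth_mem)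
    ultimately show ?thesis unfolding pos_prod_idl_iff by blast
  qed
  ultimately show ?thesis by blast
qed

end

section \<open>Existence of super sequences\<close>

theorem mainTheorem12:
  fixes \<mu> lam \<delta> \<sigma> :: "'a::wellorder"
    and lams :: "'a \<Rightarrow> 'a"
    and J :: "'a idl"
    and I :: "'a \<Rightarrow> 'a idl"
  assumes a: "strong_limit \<mu>" "singular_cardinal \<mu>"
    and b: "cardinal lam" "{..<lam} \<approx> Pow {..<\<mu>}" "cf lam = lam"
    and c: "\<delta> < \<mu>" "limit_ord \<delta>"
      "\<forall>i<\<delta>. regular_cardinal (lams i)"
      "strict_mono_on {..<\<delta>} lams"
      "unbounded_in \<mu> (lams ` {..<\<delta>})"
    and d: "is_ideal J" "Dom J = {..<\<delta>}" "small (J_bd \<delta>) \<subseteq> small J"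
    and e: "has_tcf (\<Pi>\<^sub>E i\<in>{..<\<delta>}. {..<lams i}) (less_mod J) lam"
    and f: "{..<\<delta>} \<prec> {..<\<sigma>}" "regular_cardinal \<sigma>" "\<sigma> < lams ord_zero"
    and I_def: "\<forall>i<\<delta>. I i = J_nst \<sigma> (lams i)"
  shows "(\<exists>\<eta>. lJ_sequence lam J {..<\<delta>} I \<eta>) \<and> (\<exists>\<eta>. super_lJ_sequence lam J {..<\<delta>} I \<eta>)"
proof -
  have lam_inf: "infinite {..<lam}"
    using b(2) a(2) eqpoll_finite_iff finite_Pow_iff unfolding singular_cardinal_def by blast
  have zero: "ord_zero \<le> i" for i :: 'a unfolding ord_zero_def by (rule Least_le) simp
  interpret coded_scale lam \<delta> \<sigma> lams J \<mu>
  proof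
    show "regular_cardinal lam" using b lam_inf unfolding regular_cardinal_def by blast
    show mono: "lams i < lams j" if "i < j" "j < \<delta>" for i j
      using c(4) that unfolding strict_mono_on_def by (meson lessThan_iff less_trans)
    show "\<sigma> < lams i" if "i < \<delta>" for i
    proof (cases "ord_zero = i")
      case False
      then have "ord_zero < i" using zero[of i] by simp
      then show ?thesis using f(3) mono that less_trans by blast
    qed (use f in simp)
    show "lams i \<le> \<mu>" if "i < \<delta>" for i
      using c(5) that unfolding unbounded_in_def by (simp add: image_subset_iff less_imp_le)
  qed (use a b c d e f in \<open>auto simp: singular_cardinal_def\<close>)
  from generic_sequence obtain \<eta> where
    \<eta>: "\<And>\<alpha>. \<alpha> < lam \<Longrightarrow> \<eta> \<alpha> \<in> (\<Pi>\<^sub>E i\<in>{..<\<delta>}. {..<lams i})"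
      "\<And>\<alpha> i. \<alpha> < lam \<Longrightarrow> i < \<delta> \<Longrightarrow> cf (\<eta> \<alpha> i) = \<sigma>"
    and gen: "\<And>S. club_system S \<Longrightarrow> \<exists>\<gamma><lam. \<forall>bs. sorted_wrt (<) bs \<and> set bs \<subseteq> {\<gamma><..<lam} \<longrightarrow>
        {i\<in>{..<\<delta>}. \<not> obeys (S i) (map (\<lambda>b. \<eta> b i) bs)} \<in> small J"
    by blast
  have Dom_I: "Dom (I i) = {..<lams i}" if "i < \<delta>" for i
    using I_def that by (simp add: J_nst_def)
  have pos: "\<exists>A\<in>small J. \<forall>is. set is \<subseteq> {..<\<delta>} - A \<and> sorted_wrt (<) is \<longrightarrow>
      {map (\<lambda>i. map (\<lambda>l. \<eta> (\<beta> \<alpha> l) i) [0..<n]) is | \<alpha>. \<alpha> < lam}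
        \<in> pos (prod_idl (map (\<lambda>i. prod_idl (replicate n (I i))) is))"
    if \<beta>: "\<forall>\<alpha><lam. \<forall>l<n. \<beta> \<alpha> l < lam"
      "inj_on (\<lambda>(\<alpha>, l). \<beta> \<alpha> l) ({..<lam} \<times> {..<n})"
      "\<forall>\<alpha><lam. strict_mono_on {..<n} (\<beta> \<alpha>)" for n and \<beta> :: "'a \<Rightarrow> nat \<Rightarrow> 'a"
  proof -
    obtain A where A: "A \<in> small J" "\<And>is. set is \<subseteq> {..<\<delta>} - A \<Longrightarrow> sorted_wrt (<) is \<Longrightarrow>
      {map (\<lambda>i. map (\<lambda>l. \<eta> (\<beta> \<alpha> l) i) [0..<n]) is | \<alpha>. \<alpha> < lam}
        \<in> pos (prod_idl (map (\<lambda>i. prod_idl (replicate n (J_nst \<sigma> (lams i)))) is))"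
      using tuples_positive[OF \<eta> gen \<beta>] by blast
    show ?thesis
    proof (intro bexI[OF _ A(1)] allI impI; elim conjE)
      fix "is" assume js: "set is \<subseteq> {..<\<delta>} - A" "sorted_wrt (<) is"
      have "map (\<lambda>i. prod_idl (replicate n (J_nst \<sigma> (lams i)))) is =
          map (\<lambda>i. prod_idl (replicate n (I i))) is"
        using I_def js(1) by auto
      with A(2)[OF js]
      show "{map (\<lambda>i. map (\<lambda>l. \<eta> (\<beta> \<alpha> l) i) [0..<n]) is | \<alpha>. \<alpha> < lam}
          \<in> pos (prod_idl (map (\<lambda>i. prod_idl (replicate n (I i))) is))" by simp
    qed
  qed
  \<comment> \<open>Sequences of coordinates of length one give the statement about a single coordinate.\<close>
  have single: "{map (\<lambda>l. \<eta> (\<beta> \<alpha> l) i) [0..<n] | \<alpha>. \<alpha> < lam} \<in> pos (prod_idl (replicate n (I i)))"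
    if A: "\<forall>is. set is \<subseteq> {..<\<delta>} - A \<and> sorted_wrt (<) is \<longrightarrow>
      {map (\<lambda>i. map (\<lambda>l. \<eta> (\<beta> \<alpha> l) i) [0..<n]) is | \<alpha>. \<alpha> < lam}
        \<in> pos (prod_idl (map (\<lambda>i. prod_idl (replicate n (I i))) is))" and i: "i \<in> {..<\<delta>} - A"
    for A i n and \<beta> :: "'a \<Rightarrow> nat \<Rightarrow> 'a"
  proof -
    have "(\<lambda>x. [x]) ` {map (\<lambda>l. \<eta> (\<beta> \<alpha> l) i) [0..<n] | \<alpha>. \<alpha> < lam} =
        {map (\<lambda>i. map (\<lambda>l. \<eta> (\<beta> \<alpha> l) i) [0..<n]) [i] | \<alpha>. \<alpha> < lam}" by auto
    also have "\<dots> \<in> pos (prod_idl (map (\<lambda>i. prod_idl (replicate n (I i))) [i]))"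
      using A[rule_format, of "[i]"] i by simp
    finally show ?thesis by (simp only: list.map singleton_pos_iff)
  qed
  have "{i\<in>{..<\<delta>}. {\<eta> \<alpha> i | \<alpha>. \<alpha> \<in> X} \<in> small (I i)} \<in> small J" if X: "unbounded_in lam X" for X
  proof -
    obtain h where h: "bij_betw h {..<lam} X"
      using unbounded_in_eqpoll[OF lam_regular X] eqpoll_sym unfolding eqpoll_def by blast
    \<comment> \<open>An enumeration of \<open>X\<close> is a family of 1-tuples, so the unbounded sets are the case \<open>n = 1\<close>.\<close>
    define \<beta> where "\<beta> \<alpha> l = h \<alpha>" for \<alpha> and l :: nat
    have img: "h ` {..<lam} = X" using h by (simp add: bij_betw_def)
    have "\<forall>\<alpha><lam. \<forall>l<1. \<beta> \<alpha> l < lam"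
      using img X unfolding unbounded_in_def \<beta>_def by blast
    moreover have "inj_on (\<lambda>(\<alpha>, l). \<beta> \<alpha> l) ({..<lam} \<times> {..<1})"
      using h by (auto simp: bij_betw_def inj_on_def \<beta>_def)
    moreover have "\<forall>\<alpha><lam. strict_mono_on {..<1} (\<beta> \<alpha>)" by (auto simp: strict_mono_on_def)
    ultimately obtain A where "A \<in> small J" and A: "\<forall>is. set is \<subseteq> {..<\<delta>} - A \<and> sorted_wrt (<) is \<longrightarrow>
      {map (\<lambda>i. map (\<lambda>l. \<eta> (\<beta> \<alpha> l) i) [0..<1]) is | \<alpha>. \<alpha> < lam}
        \<in> pos (prod_idl (map (\<lambda>i. prod_idl (replicate 1 (I i))) is))"
      using pos[of 1 \<beta>] by blast
    have "{\<eta> \<alpha> i | \<alpha>. \<alpha> \<in> X} \<in> pos (I i)" if "i \<in> {..<\<delta>} - A" for i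
    proof -
      have "(\<lambda>x. [x]) ` {\<eta> \<alpha> i | \<alpha>. \<alpha> \<in> X} =
          {map (\<lambda>l. \<eta> (\<beta> \<alpha> l) i) [0..<1] | \<alpha>. \<alpha> < lam}"
        unfolding img[symmetric] \<beta>_def by auto
      also have "\<dots> \<in> pos (prod_idl [I i])" using single[OF A that] by simp
      finally show ?thesis by (simp only: list.map singleton_pos_iff)
    qed
    then have "{i\<in>{..<\<delta>}. {\<eta> \<alpha> i | \<alpha>. \<alpha> \<in> X} \<in> small (I i)} \<subseteq> A" unfolding pos_def by blast
    then show ?thesis using \<open>A \<in> small J\<close> J_subset by blast
  qed
  moreover have "\<forall>\<alpha><lam. \<eta> \<alpha> \<in> (\<Pi>\<^sub>E i\<in>{..<\<delta>}. Dom (I i))"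
    using \<eta>(1) Dom_I by (auto simp: PiE_iff)
  ultimately have seq: "lJ_sequence lam J {..<\<delta>} I \<eta>" unfolding lJ_sequence_def by blast
  have "super_lJ_sequence lam J {..<\<delta>} I \<eta>" unfolding super_lJ_sequence_def
  proof (intro conjI allI impI seq; elim conjE)
    fix n and \<beta> :: "'a \<Rightarrow> nat \<Rightarrow> 'a"
    assume \<beta>: "\<forall>\<alpha><lam. \<forall>l<n. \<beta> \<alpha> l < lam"
      "inj_on (\<lambda>(\<alpha>, l). \<beta> \<alpha> l) ({..<lam} \<times> {..<n})"
      "\<forall>\<alpha><lam. strict_mono_on {..<n} (\<beta> \<alpha>)"
    obtain A where AJ: "A \<in> small J" and A: "\<forall>is. set is \<subseteq> {..<\<delta>} - A \<and> sorted_wrt (<) is \<longrightarrow>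
      {map (\<lambda>i. map (\<lambda>l. \<eta> (\<beta> \<alpha> l) i) [0..<n]) is | \<alpha>. \<alpha> < lam}
        \<in> pos (prod_idl (map (\<lambda>i. prod_idl (replicate n (I i))) is))"
      using pos[OF \<beta>] by blast
    have "{i\<in>{..<\<delta>}. {map (\<lambda>l. \<eta> (\<beta> \<alpha> l) i) [0..<n] | \<alpha>. \<alpha> < lam}
        \<in> small (prod_idl (replicate n (I i)))} \<subseteq> A"
      using single[OF A] unfolding pos_def by blast
    then show "{i\<in>{..<\<delta>}. {map (\<lambda>l. \<eta> (\<beta> \<alpha> l) i) [0..<n] | \<alpha>. \<alpha> < lam}
        \<in> small (prod_idl (replicate n (I i)))} \<in> small J"
      using AJ J_subset by blast
    show "\<exists>A\<in>small J. \<forall>(m::nat) (i :: nat \<Rightarrow> 'a).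
       (\<forall>t<m. i t \<in> {..<\<delta>} - A) \<and> strict_mono_on {..<m} i \<longrightarrow>
       {map (\<lambda>t. map (\<lambda>l. \<eta> (\<beta> \<alpha> l) (i t)) [0..<n]) [0..<m] | \<alpha>. \<alpha> < lam}
         \<in> pos (prod_idl (map (\<lambda>t. prod_idl (replicate n (I (i t)))) [0..<m]))"
    proof (intro bexI[OF _ AJ] allI impI)
      fix m and i :: "nat \<Rightarrow> 'a"
      assume i: "(\<forall>t<m. i t \<in> {..<\<delta>} - A) \<and> strict_mono_on {..<m} i"
      have "set (map i [0..<m]) \<subseteq> {..<\<delta>} - A" using i by auto
      moreover have "sorted_wrt (<) (map i [0..<m])"
        using i by (auto simp: sorted_wrt_iff_nth_less strict_mono_on_def)
      ultimately show "{map (\<lambda>t. map (\<lambda>l. \<eta> (\<beta> \<alpha> l) (i t)) [0..<n]) [0..<m] | \<alpha>. \<alpha> < lam}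
         \<in> pos (prod_idl (map (\<lambda>t. prod_idl (replicate n (I (i t)))) [0..<m]))"
        using A[rule_format, of "map i [0..<m]"] by (simp add: comp_def)
    qed
  qed
  with seq show ?thesis by blast
qed

end
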